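(* For every natural number $n$ and every positive natural number $m$, \[ \sum_{i=m}^{2m-1} \left\lfloor \frac{n+i}{2m} \right\rfloor \;-\; \sum_{i=0}^{m-1} \left\lfloor \frac{n+i}{2m} \right\rfloor \;=\; 2m \cdot \mathrm{Zigzag}\!\left(\frac{n}{2m}\right). \]
   Context: For a real number $x$, $\mathrm{Zigzag}(x) = \min\left(x - \lfloor x \rfloor,\ \lceil x \rceil - x\right)$, i.e. the distance from $x$ to the nearest integer. *)

theory Defs
  imports Complex_Main
begin

definition zigzag :: "real \<Rightarrow> real" where
  "zigzag x = min (x - of_int \<lfloor>x\<rfloor>) (of_int \<lceil>x\<rceil> - x)"

end

theory Submission
  imports Defs
begin

text \<open>With \<open>r = n mod 2m\<close>, a summand exceeds \<open>n div 2m\<close> by one precisely when \<open>i \<ge> 2m - r\<close>.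
  The upper half contains \<open>min m r\<close> such indices and the lower half \<open>max 0 (r - m)\<close>; the
  difference of these counts is \<open>min r (2m - r)\<close>, the distance from \<open>n\<close> to the nearest multiple of \<open>2m\<close>.\<close>

text \<open>Both \<open>n mod d\<close> and \<open>i\<close> lie below \<open>d\<close>, so their
  sum is below \<open>2 * d\<close> and the carry into the quotient is 0 or 1.\<close>

lemma div_add_less:
  fixes n i d :: nat
  assumes "i < d"
  shows "(n + i) div d = n div d + of_bool (d - n mod d \<le> i)"
proof -
  have "n mod d < d"
    using assms by simp
  then have "(n mod d + i) div d = of_bool (d - n mod d \<le> i)"
    using assms by (auto intro!: div_nat_eqI add_strict_mono)
  moreover have "(n + i) div d = n div d + (n mod d + i) div d"
    using assms div_add1_eq[of n i d] by simp
  ultimately show ?thesis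
    by simp
qed

text \<open>The last term counts the indices that produce a carry; truncated subtraction makes it 0
  when the threshold \<open>d - n mod d\<close> is at or beyond \<open>b\<close>.\<close>

lemma sum_div_add:
  fixes n a b d :: nat
  assumes "b \<le> d"
  shows "(\<Sum>i = a..<b. (n + i) div d) = (b - a) * (n div d) + (b - max a (d - n mod d))"
proof -
  have "(\<Sum>i = a..<b. (n + i) div d) = (\<Sum>i = a..<b. n div d + of_bool (d - n mod d \<le> i))"
    using assms by (intro sum.cong refl div_add_less) auto
  also have "\<dots> = (b - a) * (n div d) + card ({a..<b} \<inter> {i. d - n mod d \<le> i})"
    by (simp add: sum.distrib sum_of_bool_eq)
  also have "{a..<b} \<inter> {i. d - n mod d \<le> i} = {max a (d - n mod d)..<b}"
    by auto
  finally show ?thesis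
    by simp
qed

lemma zigzag_of_nat_divide:
  fixes n d :: nat
  assumes "d > 0"
  shows "real d * zigzag (real n / real d) = real (min (n mod d) (d - n mod d))"
proof -
  define q r where "q = n div d" and "r = n mod d"
  have r: "r < d"
    using assms by (simp add: r_def)
  have "real n = real d * real q + real r"
    unfolding q_def r_def by (metis mult_div_mod_eq of_nat_add of_nat_mult)
  then have x: "real n / real d = real q + real r / real d"
    using assms by (simp add: field_simps)
  have fl: "\<lfloor>real q + real r / real d\<rfloor> = int q"
    using r by (intro floor_unique) auto
  show ?thesis
  \<comment> \<open>The ceiling is \<open>q + 1\<close> only off the multiples of \<open>d\<close>;
    at a multiple both sides vanish.\<close>
  proof (cases "r = 0")
    case True
    then show ?thesis
      by (simp add: zigzag_def x flip: r_def)
  next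
    case False
    then have "\<lceil>real q + real r / real d\<rceil> = int q + 1"
      using r by (intro ceiling_unique) auto
    then have "zigzag (real n / real d) = min (real r / real d) (1 - real r / real d)"
      by (simp add: zigzag_def x fl)
    then show ?thesis
      using r by (auto simp: min_def field_simps of_nat_diff simp flip: r_def)
  qed
qed

theorem theorem2p2:
  fixes n m :: nat
  assumes "m > 0"
  shows "real_of_int ((\<Sum>i = m..2 * m - 1. \<lfloor>(real n + real i) / (2 * real m)\<rfloor>)
           - (\<Sum>i = 0..m - 1. \<lfloor>(real n + real i) / (2 * real m)\<rfloor>))
         = 2 * real m * zigzag (real n / (2 * real m))"
proof -
  define r where "r = n mod (2 * m)"
  have r: "r < 2 * m"
    using assms by (simp add: r_def)
  have fl: "\<lfloor>(real n + real i) / (2 * real m)\<rfloor> = int ((n + i) div (2 * m))" for i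
    using floor_divide_of_nat_eq[of "n + i" "2 * m"] by simp
  \<comment> \<open>Positivity of \<open>m\<close> matters here: with \<open>m = 0\<close>,
    truncation would turn \<open>{0..m - 1}\<close> into \<open>{0}\<close>.\<close>
  have ivl: "{m..2 * m - 1} = {m..<2 * m}" "{0..m - 1} = {0..<m}"
    using assms by auto
  have "(\<Sum>i = m..2 * m - 1. \<lfloor>(real n + real i) / (2 * real m)\<rfloor>)
           - (\<Sum>i = 0..m - 1. \<lfloor>(real n + real i) / (2 * real m)\<rfloor>)
      = int (\<Sum>i = m..<2 * m. (n + i) div (2 * m)) - int (\<Sum>i = 0..<m. (n + i) div (2 * m))"
    by (simp only: fl ivl of_nat_sum)
  \<comment> \<open>Both ranges have \<open>m\<close> indices, so the contributions of
    \<open>n div (2 * m)\<close> cancel and only the carry counts remain.\<close>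
  also have "\<dots> = int (2 * m - max m (2 * m - r)) - int (m - (2 * m - r))"
    by (simp add: sum_div_add flip: r_def)
  also have "\<dots> = int (min r (2 * m - r))"
    using r by linarith
  finally show ?thesis
    using zigzag_of_nat_divide[of "2 * m" n] assms by (simp flip: r_def)
qed

end
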